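(* Let $\Omega\subseteq\mathbf{R}^m$ be a convex domain and let $\mathbf{w}:\Omega\to(0,\infty)$ be an everywhere positive, continuous function that is a decreasing function of $|\zeta|$. Then $$\sup_{\zeta\in\Omega}\mathbf{w}(\zeta)\|Df(\zeta)\|=\sup_{\zeta,\eta\in\Omega,\ \zeta\ne\eta}\min\{\mathbf{w}(\zeta),\mathbf{w}(\eta)\}\frac{|f(\zeta)-f(\eta)|}{|\zeta-\eta|}$$ for every continuously differentiable mapping $f:\Omega\rightarrow\mathbf{R}^n$.
   Context: $|\cdot|$ is the Euclidean norm. A domain is a nonempty connected open set. $\|Df(\zeta)\|=\sup_{|\ell|=1}|Df(\zeta)\ell|$ is the operator norm of the differential $Df(\zeta):\mathbf{R}^m\to\mathbf{R}^n$. "$\mathbf{w}$ is a decreasing function of $|\zeta|$" means that $\mathbf{w}(\zeta)$ depends only on $|\zeta|$ and $\mathbf{w}(\zeta)\ge\mathbf{w}(\eta)$ whenever $\zeta,\eta\in\Omega$ and $|\zeta|\le|\eta|$. The suprema are taken in $[0,\infty]$ (so one side is finite if and only if the other is). *)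

theory Defs
  imports "HOL-Analysis.Analysis"
begin

end

theory Submission
  imports Defs
begin

text \<open>
  Both suprema are least upper bounds, so it suffices that every real \<open>s \<ge> 0\<close> bounds the weighted
  derivatives exactly when it bounds the weighted difference quotients.

  A bound on the quotients passes to the derivative at a point because difference quotients along a
  ray through that point converge to the directional derivative, while by continuity of the weight
  the minimum of the two weights converges to the weight at the point
  (\<open>weighted_onorm_le\<close>).

  Conversely, the segment between two points of the convex domain has its point of largest norm at
  an endpoint. A weight that decreases with the norm is therefore at least the minimum of the two
  endpoint weights on the whole segment, so the operator norm of the derivative is at most \<open>s\<close>
  divided by that minimum there, and the mean value inequality gives the bound on the quotient
  (\<open>weighted_difference_quotient_le\<close>).
\<close>

text \<open>
  The quotients at \<open>z\<close> and \<open>z + t v\<close>, multiplied by the norm of \<open>v\<close>, tend to \<open>w z * norm (D v)\<close>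
  as \<open>t\<close> decreases to \<open>0\<close>; openness of the domain keeps these points inside it.
\<close>

lemma weighted_onorm_le:
  fixes f :: "'a::real_normed_vector \<Rightarrow> 'b::real_normed_vector"
  assumes \<open>open \<Omega>\<close> and z: \<open>z \<in> \<Omega>\<close> and deriv: \<open>(f has_derivative D) (at z)\<close>
    and cont: \<open>continuous_on \<Omega> w\<close> and pos: \<open>0 < w z\<close> and \<open>0 \<le> s\<close>
    and bound: \<open>\<And>y. y \<in> \<Omega> \<Longrightarrow> y \<noteq> z \<Longrightarrow>
      min (w z) (w y) * (norm (f z - f y) / norm (z - y)) \<le> s\<close>
  shows \<open>w z * onorm D \<le> s\<close>
proof -
  interpret D: bounded_linear D
    using deriv by (rule has_derivative_bounded_linear)
  have \<open>w z * norm (D v) \<le> s * norm v\<close> if \<open>v \<noteq> 0\<close> for v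
  proof -
    let ?y = \<open>\<lambda>t. z + t *\<^sub>R v\<close>
    have y: \<open>(?y \<longlongrightarrow> z) (at_right 0)\<close>
      by (auto intro!: tendsto_eq_intros)
    have \<open>((\<lambda>t. f (?y t)) has_derivative (\<lambda>t. t *\<^sub>R D v)) (at_right 0)\<close>
      by (rule has_derivative_compose[where f = ?y and g = f, THEN has_derivative_eq_rhs])
        (auto intro!: derivative_eq_intros deriv simp: D.scaleR)
    then have lim0: \<open>((\<lambda>t. (f (?y t) - f z - t *\<^sub>R D v) /\<^sub>R norm t) \<longlongrightarrow> 0) (at_right 0)\<close>
      by (simp add: has_derivative_at_within)
    have \<open>((\<lambda>t. (f (?y t) - f z) /\<^sub>R t - D v) \<longlongrightarrow> 0) (at_right 0)\<close>
      by (rule Lim_transform_eventually[OF lim0])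
        (auto simp: eventually_at_filter scaleR_diff_right)
    then have quot: \<open>((\<lambda>t. (f (?y t) - f z) /\<^sub>R t) \<longlongrightarrow> D v) (at_right 0)\<close>
      by (simp flip: Lim_null)
    have \<open>((\<lambda>t. w (?y t)) \<longlongrightarrow> w z) (at_right 0)\<close>
      using cont \<open>open \<Omega>\<close> z y
      by (metis continuous_on_eq_continuous_at isCont_tendsto_compose)
    then have lim: \<open>((\<lambda>t. min (w z) (w (?y t)) * norm ((f (?y t) - f z) /\<^sub>R t))
        \<longlongrightarrow> min (w z) (w z) * norm (D v)) (at_right 0)\<close>
      by (intro tendsto_intros quot)
    have \<open>\<forall>\<^sub>F t in at_right 0. ?y t \<in> \<Omega>\<close>
      using topological_tendstoD[OF y \<open>open \<Omega>\<close> z] .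
    then have \<open>\<forall>\<^sub>F t in at_right 0.
        min (w z) (w (?y t)) * norm ((f (?y t) - f z) /\<^sub>R t) \<le> s * norm v\<close>
      using eventually_at_right_less[of \<open>0::real\<close>]
    proof eventually_elim
      case (elim t)
      then have eq: \<open>norm ((f (?y t) - f z) /\<^sub>R t) = norm (f z - f (?y t)) / t\<close>
        by (simp add: norm_minus_commute divide_inverse mult.commute)
      show ?case
        unfolding eq using elim bound[of \<open>?y t\<close>] \<open>v \<noteq> 0\<close>
        by (simp add: field_simps)
    qed
    from tendsto_upperbound[OF lim this] show ?thesis
      by simp
  qed
  then have \<open>norm (D v) \<le> s / w z * norm v\<close> for v
    using pos by (cases \<open>v = 0\<close>) (auto simp: field_simps D.zero)
  then have \<open>onorm D \<le> s / w z\<close>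
    using \<open>0 \<le> s\<close> pos by (intro onorm_bound) auto
  then show ?thesis
    using pos by (simp add: field_simps)
qed

text \<open>
  This is the mean value inequality on the segment from \<open>x\<close> to \<open>y\<close>; the monotonicity of the weight
  turns the pointwise bounds \<open>s / w z\<close> into one that is uniform along the segment.
\<close>

lemma weighted_difference_quotient_le:
  fixes f :: "'a::real_normed_vector \<Rightarrow> 'b::real_normed_vector"
  assumes \<open>convex \<Omega>\<close> and x: \<open>x \<in> \<Omega>\<close> and y: \<open>y \<in> \<Omega>\<close> and \<open>x \<noteq> y\<close>
    and pos: \<open>\<And>z. z \<in> \<Omega> \<Longrightarrow> 0 < w z\<close>
    and decr: \<open>\<And>z z'. z \<in> \<Omega> \<Longrightarrow> z' \<in> \<Omega> \<Longrightarrow> norm z \<le> norm z' \<Longrightarrow> w z' \<le> w z\<close>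
    and deriv: \<open>\<And>z. z \<in> \<Omega> \<Longrightarrow> (f has_derivative D z) (at z)\<close>
    and bound: \<open>\<And>z. z \<in> \<Omega> \<Longrightarrow> w z * onorm (D z) \<le> (s::real)\<close>
  shows \<open>min (w x) (w y) * (norm (f x - f y) / norm (x - y)) \<le> s\<close>
proof -
  define c where \<open>c = min (w x) (w y)\<close>
  have \<open>0 < c\<close>
    using pos x y by (simp add: c_def)
  have sub: \<open>closed_segment x y \<subseteq> \<Omega>\<close>
    using \<open>convex \<Omega>\<close> x y by (simp add: closed_segment_subset)
  have \<open>onorm (D z) \<le> s / c\<close> if z: \<open>z \<in> closed_segment x y\<close> for z
  proof -
    \<comment> \<open>Balls are convex, so the norm on the segment is at most its value at one of the endpoints.\<close>
    have \<open>z \<in> cball 0 (max (norm x) (norm y))\<close>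
      using z closed_segment_subset[of x \<open>cball 0 (max (norm x) (norm y))\<close> y] by auto
    then have \<open>c \<le> w z\<close>
      using decr[of z x] decr[of z y] x y z sub
      by (auto simp: c_def max_def min_def split: if_splits)
    moreover have \<open>0 \<le> onorm (D z)\<close>
      using z sub by (intro onorm_pos_le has_derivative_bounded_linear[OF deriv]) auto
    ultimately have \<open>c * onorm (D z) \<le> s\<close>
      using bound[of z] z sub mult_right_mono by fastforce
    then show ?thesis
      using \<open>0 < c\<close> by (simp add: field_simps)
  qed
  then have \<open>norm (f x - f y) \<le> s / c * norm (x - y)\<close>
    using sub deriv
    by (intro differentiable_bound[of \<open>closed_segment x y\<close> f D])
      (auto intro: has_derivative_at_withinI)
  then show ?thesis
    using \<open>0 < c\<close> \<open>x \<noteq> y\<close> unfolding c_def[symmetric] by (simp add: field_simps)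
qed

text \<open>
  Comparing real upper bounds suffices, as \<open>\<infinity>\<close> bounds both suprema. This keeps the analysis
  within the reals and makes the two suprema infinite together.
\<close>

lemma SUP_ennreal_eqI:
  fixes F :: \<open>'a \<Rightarrow> real\<close> and G :: \<open>'b \<Rightarrow> real\<close>
  assumes \<open>\<And>s. 0 \<le> s \<Longrightarrow> (\<forall>a\<in>A. F a \<le> s) \<longleftrightarrow> (\<forall>b\<in>B. G b \<le> s)\<close>
  shows \<open>(SUP a\<in>A. ennreal (F a)) = (SUP b\<in>B. ennreal (G b))\<close>
proof -
  have le: \<open>(SUP a\<in>A. ennreal (F a)) \<le> u \<longleftrightarrow> (SUP b\<in>B. ennreal (G b)) \<le> u\<close> for u
    using assms by (cases u) (auto simp: SUP_le_iff ennreal_le_iff)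
  show ?thesis
    using le by (meson order.antisym order.refl)
qed

theorem corollary3p1:
  fixes \<Omega> :: "(real ^ 'm) set"
    and w :: "real ^ 'm \<Rightarrow> real"
    and f :: "real ^ 'm \<Rightarrow> real ^ 'n"
    and Df :: "real ^ 'm \<Rightarrow> (real ^ 'm) \<Rightarrow>\<^sub>L (real ^ 'n)"
  assumes domain: "open \<Omega>" "connected \<Omega>" "\<Omega> \<noteq> {}"
    and convex: "convex \<Omega>"
    and w_pos: "\<And>\<zeta>. \<zeta> \<in> \<Omega> \<Longrightarrow> 0 < w \<zeta>"
    and w_cont: "continuous_on \<Omega> w"
    and w_decreasing: "\<And>\<zeta> \<eta>. \<zeta> \<in> \<Omega> \<Longrightarrow> \<eta> \<in> \<Omega> \<Longrightarrow> norm \<zeta> \<le> norm \<eta> \<Longrightarrow> w \<eta> \<le> w \<zeta>"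
    and f_deriv: "\<And>\<zeta>. \<zeta> \<in> \<Omega> \<Longrightarrow> (f has_derivative blinfun_apply (Df \<zeta>)) (at \<zeta>)"
    and Df_cont: "continuous_on \<Omega> Df"
  shows "(SUP \<zeta>\<in>\<Omega>. ennreal (w \<zeta> * onorm (blinfun_apply (Df \<zeta>)))) =
         (SUP (\<zeta>, \<eta>)\<in>{(\<zeta>, \<eta>). \<zeta> \<in> \<Omega> \<and> \<eta> \<in> \<Omega> \<and> \<zeta> \<noteq> \<eta>}.
            ennreal (min (w \<zeta>) (w \<eta>) * (norm (f \<zeta> - f \<eta>) / norm (\<zeta> - \<eta>))))"
  unfolding case_prod_beta
proof (rule SUP_ennreal_eqI, intro iffI ballI)
  fix s :: real and p
  assume \<open>\<forall>\<zeta>\<in>\<Omega>. w \<zeta> * onorm (blinfun_apply (Df \<zeta>)) \<le> s\<close>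
    and \<open>p \<in> {p. fst p \<in> \<Omega> \<and> snd p \<in> \<Omega> \<and> fst p \<noteq> snd p}\<close>
  then show \<open>min (w (fst p)) (w (snd p)) *
      (norm (f (fst p) - f (snd p)) / norm (fst p - snd p)) \<le> s\<close>
    by (intro weighted_difference_quotient_le[OF convex, where D = \<open>\<lambda>\<zeta>. blinfun_apply (Df \<zeta>)\<close>]
        w_pos w_decreasing f_deriv) auto
next
  fix s :: real and \<zeta>
  assume \<open>0 \<le> s\<close> and \<open>\<zeta> \<in> \<Omega>\<close>
    and \<open>\<forall>p\<in>{p. fst p \<in> \<Omega> \<and> snd p \<in> \<Omega> \<and> fst p \<noteq> snd p}.
      min (w (fst p)) (w (snd p)) * (norm (f (fst p) - f (snd p)) / norm (fst p - snd p)) \<le> s\<close>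
  then show \<open>w \<zeta> * onorm (blinfun_apply (Df \<zeta>)) \<le> s\<close>
    by (intro weighted_onorm_le[OF domain(1) _ f_deriv w_cont w_pos]) auto
qed

end
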